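(* Let $\mu,\sigma\in\mathbb{R}$, $\mu\neq\sigma$, and $\varepsilon>0$. Suppose the inexact Lanczos biorthogonalization described in the context is run for $j$ steps without breakdown. For $i=1,\ldots,j$ let $$r_i^{in}=\tilde{b}-(K-\mu M)\hat{u}_i(\mu)$$ be the residual of the $i$th iterate $\hat u_i(\mu)$ of the inexact algorithm applied to the linear system $(K-\mu M)u(\mu)=\tilde{b}$, and define $$r_i^{app}=(\mu-\sigma)\,\hat{\beta}_i\,v_{i+1}\,e_i^Ty_i(\mu).$$ If at each iteration $i\le j$ the inner residual vector $p_i=(K-\sigma M)\hat{z}_i-v_i$ satisfies $$\|p_i\|\le\frac{1}{j}\,\frac{\sigma_j(\mathbf{T}_j)}{\Delta_i}\,\varepsilon,$$ where $\sigma_j(\mathbf{T}_j)$ is the smallest singular value of $\mathbf{T}_j\in\mathbb{R}^{j\times j}$, then $$\|r_j^{in}\|\le\|r_j^{app}\|+\varepsilon.$$ Here $\hat z_i$, $v_i$, $\hat\beta_i$, $y_i(\mu)$, $\hat u_i(\mu)$, $\mathbf{T}_j$ and $\Delta_i$ are the quantities defined in the context.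
   Context: Throughout $\|\cdot\|$ is the Euclidean norm. **Linear system.** Let $a>0$, integers $n\ge 1$, $d\ge 2$, $P_0,\ldots,P_d\in\mathbb{R}^{n\times n}$, $0\ne b\in\mathbb{R}^n$. The Chebyshev polynomials on $[-a,a]$ are $\tau_0(\mu)=1$, $\tau_1(\mu)=\mu/a$, $\tau_{\ell+1}(\mu)=\frac{2}{a}\mu\tau_\ell(\mu)-\tau_{\ell-1}(\mu)$, and $P(\mu)=\sum_{\ell=0}^dP_\ell\tau_\ell(\mu)$ is assumed nonsingular for $\mu \in [-a,a]$. The parameter $\mu$ lies in $[-a,a]$ and the target parameter $\sigma$ lies in $(-a,a)$. $K,M\in\mathbb{R}^{dn\times dn}$ are $d\times d$ block matrices with $n\times n$ blocks: the first block row of $K$ is $[0\ I\ 0\cdots0]$; for $i=2,\ldots,d-1$ the $i$th block row of $K$ has $I$ in block columns $i-1$ and $i+1$ and zeros elsewhere; the last block row of $K$ is $[P_0\ P_1\cdots P_{d-3}\ (-P_d+P_{d-2})\ P_{d-1}]$; and $M=\frac1a\mathrm{blkdiag}(I,2I,\ldots,2I,-2P_d)$. The vector $\tilde{b}\in\mathbb{R}^{dn}$ has last block $b$ and all other blocks zero. Let $\tilde{c}\in\mathbb{R}^{dn}$ with $\tilde{b}^T\tilde{c}\ne0$. **Inexact Lanczos biorthogonalization (inexact algorithm).** Set $\hat r_0=\tilde b$, $\hat s_0=\tilde c$, $v_0=w_0=0$, and, for all $i\ge 0$, $\hat\beta_i=\|\hat r_i\|$, $\hat\gamma_i=\hat s_i^T\hat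 r_i/\hat\beta_i$. For $i=1,2,\ldots$: - $v_i=\hat r_{i-1}/\hat\beta_{i-1}$, $w_i=\hat s_{i-1}/\hat\gamma_{i-1}$; - $\hat z_i\in\mathbb{R}^{dn}$ is a computed approximation of $(K-\sigma M)^{-1}v_i$ and $\hat x_i\in\mathbb{R}^{dn}$ is a computed approximation of $(K-\sigma M)^{-T}(M^Tw_i)$ (inexact, iteration-dependent application of the preconditioner and its adjoint); - $\hat\alpha_i=w_i^TM\hat z_i$; - $\hat r_i=M\hat z_i-\hat\alpha_iv_i-\hat\gamma_{i-1}v_{i-1}$, $\quad\hat s_i=\hat x_i-\hat\alpha_iw_i-\hat\beta_{i-1}w_{i-1}$. "Without breakdown for $j$ steps" means $\hat s_i^T\hat r_i\ne0$ for $i=0,\ldots,j$ (in particular $\hat\beta_i\neq 0$ and $\hat\gamma_i\ne0$), so that $v_{i}$ and $w_{i}$ are defined for $i\le j+1$. **Tridiagonal matrices and iterates.** For $i\le j$, $\hat T_i\in\mathbb{R}^{i\times i}$ is the tridiagonal matrix with diagonal $\hat\alpha_1,\ldots,\hat\alpha_i$, superdiagonal $\hat\gamma_1,\ldots,\hat\gamma_{i-1}$ and subdiagonal $\hat\beta_1,\ldots,\hat\beta_{i-1}$. Put $\hat Z_i=[\hat z_1,\ldots,\hat z_i]$, $\beta=\|\tilde b\|=\|b\|$, and $$\mathbf{T}_i=I_i+(-\mu+\sigma)\hat T_i\in\mathbb{R}^{i\times i},$$ assumed nonsingular for $i=1,\ldots,j$. The $i$th iterate is $\hat u_i(\mu)=\hat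 Z_iy_i(\mu)$ with $y_i(\mu)=\mathbf{T}_i^{-1}(\beta e_1)\in\mathbb{R}^i$. Here $e_1$ and $e_i$ denote the first and $i$th columns of $I_i$. **The quantities $\Delta_i$.** Let $\underline{\mathbf{T}}_i\in\mathbb{R}^{(i+1)\times i}$ be $\mathbf{T}_i$ with the additional last row $(-\mu+\sigma)\hat\beta_i\,e_i^T$, and write $\underline{\mathbf{t}}_{i+1,i}=(-\mu+\sigma)\hat\beta_i$ for its $(i+1,i)$ entry. For each $i$ let $Q_{i-1}^T=\Omega_{i-1}\cdots\Omega_1\in\mathbb{R}^{i\times i}$ (with $Q_0=1$) be the product of Givens rotations, where $\Omega_k$ is the identity except for the block $\begin{bmatrix}c_k&s_k\\-s_k&c_k\end{bmatrix}$ (with $c_k^2+s_k^2=1$) in rows and columns $k,k+1$, successively chosen to eliminate the subdiagonal entries $\underline{\mathbf{t}}_{k+1,k}$ of $\underline{\mathbf{T}}_{i-1}$, $k=1,\ldots,i-1$. Then $\tilde R_i=Q_{i-1}^T\mathbf{T}_i$ is upper triangular; let $\tilde r_{i,i}$ be its $(i,i)$ entry. Define $$\Delta_i=\frac{|\tilde r_{i,i}|}{|\underline{\mathbf{t}}_{i+1,i}|}\,\|r_i^{app}\|=|\tilde r_{i,i}|\,|(y_i(\mu))_i|=\beta\,|s_1\cdots s_{i-1}|,$$ where $(y_i(\mu))_i$ is the $i$th component of $y_i(\mu)$ and the empty product is $1$. *)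

theory Defs
  imports
    "HOL-Analysis.L2_Norm"
    "Jordan_Normal_Form.Gauss_Jordan_Elimination"
    "Jordan_Normal_Form.Char_Poly"
begin

text \<open>
  Vectors and matrices are the dimension-carrying ones of Jordan_Normal_Form, whose entries are
  indexed from 0.  Blocks of block matrices, Lanczos steps and Givens rotations are numbered from 1.
\<close>

definition vnorm :: "real vec \<Rightarrow> real" where
  "vnorm v = L2_set (\<lambda>i. v $ i) {..<dim_vec v}"

definition singular_values :: "real mat \<Rightarrow> real set" where
  "singular_values A = sqrt ` {e. eigenvalue (transpose_mat A * A) e}"

text \<open>For a square matrix this is the last singular value in decreasing order.\<close>

definition smallest_singular_value :: "real mat \<Rightarrow> real" where
  "smallest_singular_value A = Min (singular_values A)"


text \<open>The function \<open>cheb a l\<close> is the Chebyshev polynomial of degree \<open>l\<close> scaled to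
  the interval from \<open>-a\<close> to \<open>a\<close>.\<close>

fun cheb :: "real \<Rightarrow> nat \<Rightarrow> real \<Rightarrow> real" where
  "cheb a 0 \<mu> = 1"
| "cheb a (Suc 0) \<mu> = \<mu> / a"
| "cheb a (Suc (Suc l)) \<mu> = 2 / a * \<mu> * cheb a (Suc l) \<mu> - cheb a l \<mu>"

definition cheb_matrix :: "real \<Rightarrow> nat \<Rightarrow> nat \<Rightarrow> (nat \<Rightarrow> real mat) \<Rightarrow> real \<Rightarrow> real mat" where
  "cheb_matrix a d n P \<mu> = mat n n (\<lambda>(p, q). \<Sum>l\<le>d. P l $$ (p, q) * cheb a l \<mu>)"

definition block_mat :: "nat \<Rightarrow> nat \<Rightarrow> (nat \<Rightarrow> nat \<Rightarrow> real mat) \<Rightarrow> real mat" where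
  "block_mat d n B = mat (d * n) (d * n)
     (\<lambda>(p, q). B (p div n + 1) (q div n + 1) $$ (p mod n, q mod n))"

definition pencil_K :: "nat \<Rightarrow> nat \<Rightarrow> (nat \<Rightarrow> real mat) \<Rightarrow> real mat" where
  "pencil_K d n P = block_mat d n (\<lambda>i k.
     if i = d then (if k = d - 1 then - P d + P (d - 2) else P (k - 1))
     else if i = 1 then (if k = 2 then 1\<^sub>m n else 0\<^sub>m n n)
     else (if k = i - 1 \<or> k = i + 1 then 1\<^sub>m n else 0\<^sub>m n n))"

definition pencil_M :: "real \<Rightarrow> nat \<Rightarrow> nat \<Rightarrow> (nat \<Rightarrow> real mat) \<Rightarrow> real mat" where
  "pencil_M a d n P = (1 / a) \<cdot>\<^sub>m
     diag_block_mat ([1\<^sub>m n] @ replicate (d - 2) (2 \<cdot>\<^sub>m 1\<^sub>m n) @ [(-2) \<cdot>\<^sub>m P d])"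

definition pencil_rhs :: "nat \<Rightarrow> nat \<Rightarrow> real vec \<Rightarrow> real vec" where
  "pencil_rhs d n b = 0\<^sub>v ((d - 1) * n) @\<^sub>v b"


text \<open>
  The sequences \<open>v, w, r, s, \<alpha>, \<beta>, \<gamma>\<close> are produced by \<open>j\<close> steps of the inexact Lanczos
  biorthogonalization in dimension \<open>N\<close>, started with \<open>bt\<close> and \<open>ct\<close>.  The vectors \<open>z i\<close>
  and \<open>x i\<close> are the computed approximations of the two preconditioner applications; as no
  accuracy is prescribed by the algorithm, they are arbitrary vectors.  Given \<open>z\<close> and \<open>x\<close>,
  the equations determine all the other quantities up to step \<open>j\<close>.
\<close>

definition inexact_lanczos ::
  "nat \<Rightarrow> real mat \<Rightarrow> real vec \<Rightarrow> real vec \<Rightarrow> nat \<Rightarrow> (nat \<Rightarrow> real vec) \<Rightarrow> (nat \<Rightarrow> real vec) \<Rightarrow>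
   (nat \<Rightarrow> real vec) \<Rightarrow> (nat \<Rightarrow> real vec) \<Rightarrow> (nat \<Rightarrow> real vec) \<Rightarrow> (nat \<Rightarrow> real vec) \<Rightarrow>
   (nat \<Rightarrow> real) \<Rightarrow> (nat \<Rightarrow> real) \<Rightarrow> (nat \<Rightarrow> real) \<Rightarrow> bool" where
  "inexact_lanczos N M bt ct j z x v w r s \<alpha> \<beta> \<gamma> \<longleftrightarrow>
     r 0 = bt \<and> s 0 = ct \<and> v 0 = 0\<^sub>v N \<and> w 0 = 0\<^sub>v N \<and>
     (\<forall>i\<le>j. \<beta> i = vnorm (r i) \<and> \<gamma> i = (s i \<bullet> r i) / \<beta> i) \<and>
     (\<forall>i\<in>{1..j+1}. v i = (1 / \<beta> (i-1)) \<cdot>\<^sub>v r (i-1) \<and> w i = (1 / \<gamma> (i-1)) \<cdot>\<^sub>v s (i-1)) \<and>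
     (\<forall>i\<in>{1..j}.
        z i \<in> carrier_vec N \<and> x i \<in> carrier_vec N \<and>
        \<alpha> i = w i \<bullet> (M *\<^sub>v z i) \<and>
        r i = M *\<^sub>v z i - \<alpha> i \<cdot>\<^sub>v v i - \<gamma> (i-1) \<cdot>\<^sub>v v (i-1) \<and>
        s i = x i - \<alpha> i \<cdot>\<^sub>v w i - \<beta> (i-1) \<cdot>\<^sub>v w (i-1))"

definition no_breakdown :: "nat \<Rightarrow> (nat \<Rightarrow> real vec) \<Rightarrow> (nat \<Rightarrow> real vec) \<Rightarrow> bool" where
  "no_breakdown j r s \<longleftrightarrow> (\<forall>i\<le>j. s i \<bullet> r i \<noteq> 0)"

text \<open>Diagonal \<open>\<alpha> 1, \<dots>, \<alpha> i\<close>, superdiagonal \<open>\<gamma> 1, \<dots>, \<gamma> (i-1)\<close>, subdiagonal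
  \<open>\<beta> 1, \<dots>, \<beta> (i-1)\<close>.\<close>

definition tridiag :: "(nat \<Rightarrow> real) \<Rightarrow> (nat \<Rightarrow> real) \<Rightarrow> (nat \<Rightarrow> real) \<Rightarrow> nat \<Rightarrow> real mat" where
  "tridiag \<alpha> \<beta> \<gamma> i = mat i i (\<lambda>(p, q).
     if p = q then \<alpha> (p + 1)
     else if q = p + 1 then \<gamma> (p + 1)
     else if p = q + 1 then \<beta> (q + 1)
     else 0)"

definition append_last_entry :: "real mat \<Rightarrow> real \<Rightarrow> real mat" where
  "append_last_entry A t = A @\<^sub>r mat_of_row (t \<cdot>\<^sub>v unit_vec (dim_col A) (dim_col A - 1))"


definition givens_rotation :: "nat \<Rightarrow> real \<Rightarrow> real \<Rightarrow> nat \<Rightarrow> real mat" where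
  "givens_rotation m c s k = mat m m (\<lambda>(p, q).
     if (p, q) = (k - 1, k - 1) \<or> (p, q) = (k, k) then c
     else if (p, q) = (k - 1, k) then s
     else if (p, q) = (k, k - 1) then - s
     else if p = q then 1 else 0)"

text \<open>The \<open>m\<close> by \<open>m\<close> product of the first \<open>k\<close> rotations, the latest one leftmost.\<close>

primrec givens_product :: "nat \<Rightarrow> (nat \<Rightarrow> real) \<Rightarrow> (nat \<Rightarrow> real) \<Rightarrow> nat \<Rightarrow> real mat" where
  "givens_product m c s 0 = 1\<^sub>m m"
| "givens_product m c s (Suc k) =
     givens_rotation m (c (Suc k)) (s (Suc k)) (Suc k) * givens_product m c s k"

text \<open>
  For every \<open>i \<le> j\<close> the rotations \<open>1, \<dots>, i-1\<close> successively eliminate the subdiagonal of the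
  \<open>i\<close> by \<open>i-1\<close> matrix \<open>Tu (i-1)\<close>; entry \<open>(k, k-1)\<close>, counted from 0, lies in row \<open>k+1\<close>,
  column \<open>k\<close>.  This determines each rotation only up to sign.
\<close>

definition givens_eliminates ::
  "nat \<Rightarrow> (nat \<Rightarrow> real mat) \<Rightarrow> (nat \<Rightarrow> real) \<Rightarrow> (nat \<Rightarrow> real) \<Rightarrow> bool" where
  "givens_eliminates j Tu c s \<longleftrightarrow>
     (\<forall>i\<in>{1..j}. \<forall>k\<in>{1..i-1}.
        (c k)\<^sup>2 + (s k)\<^sup>2 = 1 \<and> (givens_product i c s k * Tu (i-1)) $$ (k, k-1) = 0)"

end

theory Submission
  imports Defs
begin

text \<open>
  By the Lanczos recurrence the true residual differs from the approximate one by
  \<open>\<Sum>i. (y j)\<^sub>i p i\<close>, so it suffices that \<open>\<sigma>_min (T j)\<close> times the \<open>i\<close>th component of \<open>y j\<close> is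
  at most \<open>\<Delta> i\<close>.  Apply the first \<open>i - 1\<close> rotations to \<open>T j y = \<beta> e\<^sub>1\<close>.  The matrix becomes block
  upper triangular, and the trailing part of the right-hand side is a multiple \<open>\<rho>\<close> of a unit vector,
  with \<open>\<bar>\<rho>\<bar> = \<Delta> i\<close>.  Keeping the trailing part of \<open>y\<close> and solving the leading block anew gives a
  vector \<open>x\<close> with the same \<open>i\<close>th component whose image has norm \<open>\<Delta> i\<close>.
\<close>

subsection \<open>The smallest singular value\<close>

lemma vnorm_sq: "(vnorm x)\<^sup>2 = x \<bullet> x"
  by (simp add: vnorm_def L2_set_def scalar_prod_def sum_nonneg power2_eq_square lessThan_atLeast0)

lemma vnorm_nonneg: "0 \<le> vnorm x"
  by (simp add: vnorm_def)

lemma scalar_prod_self_nonneg: "0 \<le> x \<bullet> (x :: real vec)"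
  by (simp add: scalar_prod_def sum_nonneg)

lemma scalar_prod_self_pos:
  fixes x :: "real vec"
  assumes "x \<in> carrier_vec n" "x \<noteq> 0\<^sub>v n"
  shows "0 < x \<bullet> x"
proof -
  obtain i where i: "i < n" "x $ i \<noteq> 0"
    using assms by (metis carrier_vecD eq_vecI index_zero_vec)
  have "0 < (\<Sum>i = 0..<n. x $ i * x $ i)"
    by (rule sum_pos2[of _ i]) (use i in \<open>auto simp: zero_less_mult_iff\<close>)
  then show ?thesis using assms by (simp add: scalar_prod_def)
qed

text \<open>Used below to complete the square in direction \<open>w\<close>. The two mixed terms are
  merged only there, where symmetry is available.\<close>

lemma mult_mat_vec_smult_add:
  fixes A :: "real mat"
  assumes "A \<in> carrier_mat n n" "x \<in> carrier_vec n" "w \<in> carrier_vec n"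
  shows "(x + t \<cdot>\<^sub>v w) \<bullet> (A *\<^sub>v (x + t \<cdot>\<^sub>v w)) =
    x \<bullet> (A *\<^sub>v x) + t * (x \<bullet> (A *\<^sub>v w)) + t * (w \<bullet> (A *\<^sub>v x)) + t\<^sup>2 * (w \<bullet> (A *\<^sub>v w))"
proof -
  have c: "A *\<^sub>v x \<in> carrier_vec n" "A *\<^sub>v w \<in> carrier_vec n" using assms by auto
  have "A *\<^sub>v (x + t \<cdot>\<^sub>v w) = A *\<^sub>v x + t \<cdot>\<^sub>v (A *\<^sub>v w)"
    using assms by (simp add: mult_add_distrib_mat_vec[of _ n n] mult_mat_vec[of _ n n])
  then show ?thesis
    using assms c
    by (simp add: scalar_prod_add_distrib[of _ n] add_scalar_prod_distrib[of _ n] power2_eq_square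
      algebra_simps)
qed

text \<open>Every product of two entries of \<open>x\<close> is at most
  \<open>x \<bullet> x\<close>, so the absolute values of the entries of \<open>B\<close> add up to
  a bound. The extra summand 1 keeps \<open>C\<close> positive even for a zero matrix, so that
  \<open>1 / C\<close> can be used as an increment.\<close>

lemma quadratic_form_bounded:
  fixes B :: "real mat"
  assumes "B \<in> carrier_mat n n"
  obtains C where "C > 0" "\<And>x. x \<in> carrier_vec n \<Longrightarrow> \<bar>x \<bullet> (B *\<^sub>v x)\<bar> \<le> C * (x \<bullet> x)"
proof
  let ?S = "\<Sum>p<n. \<Sum>q<n. \<bar>B $$ (p, q)\<bar>"
  show "1 + ?S > 0" by (smt (verit) sum_nonneg abs_ge_zero)
  fix x :: "real vec" assume x: "x \<in> carrier_vec n"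
  have xx: "x \<bullet> x = (\<Sum>p<n. (x $ p)\<^sup>2)"
    using x by (simp add: scalar_prod_def lessThan_atLeast0 power2_eq_square)
  have le: "(x $ p)\<^sup>2 \<le> x \<bullet> x" if "p < n" for p
    unfolding xx by (rule member_le_sum) (use that in auto)
  have prod: "\<bar>x $ p * x $ q\<bar> \<le> x \<bullet> x" if "p < n" "q < n" for p q
  proof -
    have "2 * \<bar>x $ p * x $ q\<bar> \<le> (x $ p)\<^sup>2 + (x $ q)\<^sup>2"
      using sum_squares_bound[of "\<bar>x $ p\<bar>" "\<bar>x $ q\<bar>"] by (simp add: abs_mult)
    then show ?thesis using le[OF that(1)] le[OF that(2)] by simp
  qed
  have "x \<bullet> (B *\<^sub>v x) = (\<Sum>p<n. x $ p * (\<Sum>q<n. B $$ (p, q) * x $ q))"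
    using x assms by (simp add: scalar_prod_def lessThan_atLeast0)
  also have "\<dots> = (\<Sum>p<n. \<Sum>q<n. B $$ (p, q) * (x $ p * x $ q))"
    by (simp add: sum_distrib_left mult_ac)
  also have "\<bar>\<dots>\<bar> \<le> (\<Sum>p<n. \<Sum>q<n. \<bar>B $$ (p, q)\<bar> * (x \<bullet> x))"
    by (intro order.trans[OF sum_abs] sum_mono)
      (auto simp: abs_mult[of "B $$ _"] intro!: mult_left_mono prod)
  also have "\<dots> \<le> (1 + ?S) * (x \<bullet> x)"
    using scalar_prod_self_nonneg[of x] by (simp add: sum_distrib_right distrib_right)
  finally show "\<bar>x \<bullet> (B *\<^sub>v x)\<bar> \<le> (1 + ?S) * (x \<bullet> x)" .
qed

section \<open>An eigenvalue that bounds the quadratic form from below\<close>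

lemma smult_one_mult_vec:
  fixes x :: "real vec"
  assumes "x \<in> carrier_vec n"
  shows "(l \<cdot>\<^sub>m 1\<^sub>m n) *\<^sub>v x = l \<cdot>\<^sub>v x"
proof (rule eq_vecI)
  fix i assume "i < dim_vec (l \<cdot>\<^sub>v x)"
  then show "((l \<cdot>\<^sub>m 1\<^sub>m n) *\<^sub>v x) $ i = (l \<cdot>\<^sub>v x) $ i"
    using assms by simp
qed (use assms in simp)

text \<open>The largest \<open>l\<close> for which \<open>S - l I\<close> is positive semidefinite is an eigenvalue: if \<open>S - l I\<close>
  were invertible, completing the square with its inverse would give it a positive lower bound.\<close>

lemma symmetric_eigenvalue_lower_bound:
  fixes S :: "real mat"
  assumes S: "S \<in> carrier_mat n n" and sym: "transpose_mat S = S" and n: "0 < n"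
  obtains l where "eigenvalue S l" "\<And>x. x \<in> carrier_vec n \<Longrightarrow> l * (x \<bullet> x) \<le> x \<bullet> (S *\<^sub>v x)"
proof -
  define L where "L = {l. \<forall>x \<in> carrier_vec n. l * (x \<bullet> x) \<le> x \<bullet> (S *\<^sub>v x)}"
  obtain C where C: "\<And>x. x \<in> carrier_vec n \<Longrightarrow> \<bar>x \<bullet> (S *\<^sub>v x)\<bar> \<le> C * (x \<bullet> x)"
    using quadratic_form_bounded[OF S] by blast
  have "- C \<in> L"
    unfolding L_def using C by (force simp: abs_le_iff)
  then have ne: "L \<noteq> {}" by auto
  have ub: "l \<le> (x \<bullet> (S *\<^sub>v x)) / (x \<bullet> x)"
    if "l \<in> L" "x \<in> carrier_vec n" "x \<noteq> 0\<^sub>v n" for l x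
    using that scalar_prod_self_pos[OF that(2,3)] by (simp add: L_def pos_le_divide_eq)
  \<comment> \<open>\<open>0 < n\<close> supplies a nonzero vector, and its Rayleigh quotient bounds
    \<open>L\<close> from above.\<close>
  have u0: "unit_vec n 0 \<in> carrier_vec n" "unit_vec n 0 \<noteq> (0\<^sub>v n :: real vec)"
    using n by (auto simp: vec_eq_iff)
  have bdd: "bdd_above L" unfolding bdd_above_def using ub[OF _ u0] by blast
  define l where "l = Sup L"
  \<comment> \<open>The supremum itself lies in \<open>L\<close>, because each Rayleigh quotient is
    an upper bound of \<open>L\<close>.\<close>
  have l: "l * (x \<bullet> x) \<le> x \<bullet> (S *\<^sub>v x)" if x: "x \<in> carrier_vec n" for x
  proof (cases "x = 0\<^sub>v n")
    case True
    then show ?thesis using S by simp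
  next
    case False
    have "l \<le> (x \<bullet> (S *\<^sub>v x)) / (x \<bullet> x)"
      unfolding l_def using ne ub[OF _ x False] by (rule cSup_least)
    then show ?thesis using scalar_prod_self_pos[OF x False] by (simp add: pos_le_divide_eq)
  qed
  define B where "B = S - l \<cdot>\<^sub>m 1\<^sub>m n"
  have B: "B \<in> carrier_mat n n" unfolding B_def using S by (intro minus_carrier_mat) auto
  have Bx: "B *\<^sub>v x = S *\<^sub>v x - l \<cdot>\<^sub>v x" if "x \<in> carrier_vec n" for x
    using S that unfolding B_def
    by (subst minus_mult_distrib_mat_vec[of _ n n]) (auto simp: smult_one_mult_vec)
  have qB: "x \<bullet> (B *\<^sub>v x) = x \<bullet> (S *\<^sub>v x) - l * (x \<bullet> x)" if "x \<in> carrier_vec n" for x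
    using S that by (simp add: Bx scalar_prod_minus_distrib[of _ n])
  have symB: "transpose_mat B = B"
  proof (rule eq_matI)
    fix p q assume pq: "p < dim_row B" "q < dim_col B"
    have "S $$ (q, p) = transpose_mat S $$ (p, q)" using pq S B by simp
    then show "transpose_mat B $$ (p, q) = B $$ (p, q)"
      using pq S B by (auto simp: B_def sym)
  qed (use B in auto)
  have det: "det B = 0"
  proof (rule ccontr)
    assume "det B \<noteq> 0"
    then obtain B' where B': "B' \<in> carrier_mat n n" "B * B' = 1\<^sub>m n"
      using det_non_zero_imp_unit[OF B] by (auto simp: Units_def ring_mat_def)
    obtain C where Cpos: "C > 0"
      and C: "\<And>x. x \<in> carrier_vec n \<Longrightarrow> \<bar>x \<bullet> (B' *\<^sub>v x)\<bar> \<le> C * (x \<bullet> x)"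
      using quadratic_form_bounded[OF B'(1)] by blast
    have "(l + 1 / C) * (x \<bullet> x) \<le> x \<bullet> (S *\<^sub>v x)" if x: "x \<in> carrier_vec n" for x
    proof -
      \<comment> \<open>Since \<open>B\<close> maps \<open>?w\<close> to \<open>x\<close>, the form
        of \<open>B\<close> at \<open>x + t ?w\<close> is at most
        \<open>x \<bullet> B x + (2 t + C t^2) (x \<bullet> x)\<close>. The choice
        \<open>t = - 1 / C\<close> minimizes the coefficient, with value \<open>- 1 / C\<close>. As
        the form is nonnegative, \<open>1 / C\<close> could be added to \<open>l\<close>, against
        its maximality.\<close>
      let ?w = "B' *\<^sub>v x" and ?t = "- (1 / C)"
      have w: "?w \<in> carrier_vec n" using B' x by simp
      have Bw: "B *\<^sub>v ?w = x"
        using B B' x by (simp flip: assoc_mult_mat_vec[of _ n n _ n])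
      have wBx: "?w \<bullet> (B *\<^sub>v x) = x \<bullet> x"
        using transpose_vec_mult_scalar[of B n n x ?w] B x w symB Bw by simp
      have xt: "x + ?t \<cdot>\<^sub>v ?w \<in> carrier_vec n" using x w by simp
      have wx: "?w \<bullet> x = x \<bullet> ?w" using x w by (rule comm_scalar_prod[rotated])
      have "0 \<le> (x + ?t \<cdot>\<^sub>v ?w) \<bullet> (B *\<^sub>v (x + ?t \<cdot>\<^sub>v ?w))"
        using qB[OF xt] l[OF xt] by simp
      also have "\<dots> = x \<bullet> (B *\<^sub>v x) - 2 / C * (x \<bullet> x) + (1 / C)\<^sup>2 * (x \<bullet> ?w)"
        unfolding mult_mat_vec_smult_add[OF B x w] Bw wBx wx by simp
      also have "\<dots> \<le> x \<bullet> (B *\<^sub>v x) - 2 / C * (x \<bullet> x) + (1 / C)\<^sup>2 * (C * (x \<bullet> x))"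
        using C[OF x] by (intro add_left_mono mult_left_mono) auto
      also have "\<dots> = x \<bullet> (B *\<^sub>v x) - 1 / C * (x \<bullet> x)"
        using Cpos by (simp add: power2_eq_square field_simps)
      finally show ?thesis using qB[OF x] by (simp add: distrib_right)
    qed
    then have "l + 1 / C \<in> L" by (simp add: L_def)
    then have "l + 1 / C \<le> l" unfolding l_def using bdd by (rule cSup_upper)
    then show False using Cpos by simp
  qed
  then obtain x where x: "x \<in> carrier_vec n" "x \<noteq> 0\<^sub>v n" "B *\<^sub>v x = 0\<^sub>v n"
    using det_0_iff_vec_prod_zero_field[OF B] by blast
  have "S *\<^sub>v x = l \<cdot>\<^sub>v x"
  proof (rule eq_vecI)
    fix i assume "i < dim_vec (l \<cdot>\<^sub>v x)"
    then have "i < n" using x by simp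
    then have "(S *\<^sub>v x - l \<cdot>\<^sub>v x) $ i = 0" using x Bx by simp
    then show "(S *\<^sub>v x) $ i = (l \<cdot>\<^sub>v x) $ i" using \<open>i < n\<close> S x by simp
  qed (use S x in auto)
  then have "eigenvalue S l"
    using S x unfolding eigenvalue_def eigenvector_def by auto
  then show ?thesis using that l by blast
qed

text \<open>The quadratic form of the Gram matrix \<open>transpose_mat A * A\<close> at
  \<open>x\<close> is the squared norm of \<open>A *\<^sub>v x\<close>. Its eigenvalues are
  therefore nonnegative, and an eigenvalue \<open>l\<close> bounding the form from below gives the
  estimate with \<open>sqrt l\<close>, which the minimum cannot exceed.\<close>

lemma smallest_singular_value_bound:
  assumes A: "A \<in> carrier_mat n n" and n: "0 < n"
  shows smallest_singular_value_nonneg: "0 \<le> smallest_singular_value A"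
    and smallest_singular_value_le:
      "\<And>x. x \<in> carrier_vec n \<Longrightarrow> smallest_singular_value A * vnorm x \<le> vnorm (A *\<^sub>v x)"
proof -
  let ?S = "transpose_mat A * A"
  have S: "?S \<in> carrier_mat n n" using A by simp
  have "transpose_mat ?S = ?S"
    using A by (simp add: transpose_mult[of _ n n _ n])
  then obtain l where l: "eigenvalue ?S l"
    "\<And>x. x \<in> carrier_vec n \<Longrightarrow> l * (x \<bullet> x) \<le> x \<bullet> (?S *\<^sub>v x)"
    using symmetric_eigenvalue_lower_bound[OF S _ n] by metis
  have form: "x \<bullet> (?S *\<^sub>v x) = (vnorm (A *\<^sub>v x))\<^sup>2" if x: "x \<in> carrier_vec n" for x
  proof -
    have "?S *\<^sub>v x = transpose_mat A *\<^sub>v (A *\<^sub>v x)"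
      using A x by (simp add: assoc_mult_mat_vec[of _ n n _ n])
    then have "x \<bullet> (?S *\<^sub>v x) = (transpose_mat A *\<^sub>v (A *\<^sub>v x)) \<bullet> x"
      using A x by (metis comm_scalar_prod mult_mat_vec_carrier transpose_carrier_mat)
    then show ?thesis
      using A x transpose_vec_mult_scalar[of A n n x "A *\<^sub>v x"] by (simp add: vnorm_sq)
  qed
  have nonneg: "0 \<le> e" if e: "eigenvalue ?S e" for e
  proof -
    obtain x where x: "x \<in> carrier_vec n" "x \<noteq> 0\<^sub>v n" "?S *\<^sub>v x = e \<cdot>\<^sub>v x"
      using e A unfolding eigenvalue_def eigenvector_def by auto
    then have "e * (x \<bullet> x) = (vnorm (A *\<^sub>v x))\<^sup>2" using form[of x] by simp
    then have "0 \<le> e * (x \<bullet> x)" by simp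
    then show ?thesis using scalar_prod_self_pos[OF x(1,2)] by (simp add: zero_le_mult_iff)
  qed
  \<comment> \<open>\<open>Min\<close> needs a finite nonempty set: the eigenvalues are roots of a
    nonzero polynomial, and \<open>l\<close> is one of them.\<close>
  have "{e. eigenvalue ?S e} \<subseteq> {e. poly (char_poly ?S) e = 0}"
    using eigenvalue_root_char_poly[OF S] by auto
  moreover have "char_poly ?S \<noteq> 0" using degree_monic_char_poly[OF S] by auto
  ultimately have fin: "finite (singular_values A)"
    unfolding singular_values_def
    by (intro finite_imageI) (rule finite_subset[OF _ poly_roots_finite])
  have mem: "sqrt l \<in> singular_values A" using l(1) by (simp add: singular_values_def)
  then have "smallest_singular_value A \<in> singular_values A"
    unfolding smallest_singular_value_def using fin by (intro Min_in) auto
  then show "0 \<le> smallest_singular_value A"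
    using nonneg by (auto simp: singular_values_def)
  fix x :: "real vec" assume x: "x \<in> carrier_vec n"
  have "smallest_singular_value A \<le> sqrt l"
    unfolding smallest_singular_value_def using fin mem by (rule Min_le)
  then have "smallest_singular_value A * vnorm x \<le> sqrt l * vnorm x"
    by (simp add: mult_right_mono vnorm_nonneg)
  also have "\<dots> \<le> vnorm (A *\<^sub>v x)"
  proof (rule power2_le_imp_le)
    have "(sqrt l * vnorm x)\<^sup>2 = l * (x \<bullet> x)"
      using nonneg[OF l(1)] by (simp only: power_mult_distrib real_sqrt_pow2 vnorm_sq)
    also have "\<dots> \<le> (vnorm (A *\<^sub>v x))\<^sup>2"
      using l(2)[OF x] unfolding form[OF x] .
    finally show "(sqrt l * vnorm x)\<^sup>2 \<le> (vnorm (A *\<^sub>v x))\<^sup>2" .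
  qed (rule vnorm_nonneg)
  finally show "smallest_singular_value A * vnorm x \<le> vnorm (A *\<^sub>v x)" .
qed

subsection \<open>Givens rotations of a Hessenberg matrix\<close>

text \<open>The rotations act here on a column given as an infinite sequence, so one expression
  serves the products of all sizes \<open>m\<close>. Rotation \<open>Suc k\<close> mixes the entries
  \<open>k\<close> and \<open>Suc k\<close>, counted from 0.\<close>

fun givens_apply :: "(nat \<Rightarrow> real) \<Rightarrow> (nat \<Rightarrow> real) \<Rightarrow> nat \<Rightarrow> (nat \<Rightarrow> real) \<Rightarrow> nat \<Rightarrow> real" where
  "givens_apply c s 0 f = f"
| "givens_apply c s (Suc k) f =
     (givens_apply c s k f)
       (k := c (Suc k) * givens_apply c s k f k + s (Suc k) * givens_apply c s k f (Suc k),
        Suc k := - s (Suc k) * givens_apply c s k f k + c (Suc k) * givens_apply c s k f (Suc k))"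

lemma givens_product_carrier [simp]: "givens_product m c s k \<in> carrier_mat m m"
  by (induction k) (auto simp: givens_rotation_def)

lemma givens_rotation_mult_index:
  assumes X: "X \<in> carrier_mat m n" and k: "Suc k < m" and p: "p < m" and q: "q < n"
  shows "(givens_rotation m a b (Suc k) * X) $$ (p, q) =
    (if p = k then a * X $$ (k, q) + b * X $$ (Suc k, q)
     else if p = Suc k then - b * X $$ (k, q) + a * X $$ (Suc k, q)
     else X $$ (p, q))"
proof -
  have "(givens_rotation m a b (Suc k) * X) $$ (p, q) =
      (\<Sum>l<m. givens_rotation m a b (Suc k) $$ (p, l) * X $$ (l, q))"
    using X p q by (simp add: scalar_prod_def givens_rotation_def lessThan_atLeast0)
  \<comment> \<open>Row \<open>p\<close> of the rotation is its diagonal entry plus at most one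
    off-diagonal entry, so each of the three sums has at most one nonzero term.\<close>
  also have "\<dots> = (\<Sum>l<m. (if l = p then (if p = k \<or> p = Suc k then a else 1) * X $$ (l, q) else 0) +
      (if l = k then (if p = Suc k then - b else 0) * X $$ (l, q) else 0) +
      (if l = Suc k then (if p = k then b else 0) * X $$ (l, q) else 0))"
    using p by (intro sum.cong) (auto simp: givens_rotation_def)
  finally show ?thesis
    using p k by (simp add: sum.distrib)
qed

text \<open>The bridge from matrix products to sequences. The condition \<open>k < m\<close> keeps
  both rows of every rotation inside the matrix.\<close>

lemma givens_product_mult_index:
  assumes "A \<in> carrier_mat m n" "k < m" "p < m" "q < n"
  shows "(givens_product m c s k * A) $$ (p, q) = givens_apply c s k (\<lambda>p. A $$ (p, q)) p"
  using assms(2,3)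
proof (induction k arbitrary: p)
  case 0
  then show ?case using assms by simp
next
  case (Suc k)
  have "givens_rotation m (c (Suc k)) (s (Suc k)) (Suc k) \<in> carrier_mat m m"
    by (simp add: givens_rotation_def)
  then have eq: "givens_product m c s (Suc k) * A =
      givens_rotation m (c (Suc k)) (s (Suc k)) (Suc k) * (givens_product m c s k * A)"
    using assms(1) by (simp add: assoc_mult_mat[of _ m m _ m _ n])
  have X: "givens_product m c s k * A \<in> carrier_mat m n"
    by (rule mult_carrier_mat[OF givens_product_carrier assms(1)])
  show ?case
    unfolding eq givens_rotation_mult_index[OF X Suc.prems assms(4)]
    using Suc by (simp del: index_mult_mat)
qed

text \<open>The first \<open>k\<close> rotations mix only the entries \<open>0\<close> to
  \<open>k\<close>, all below \<open>m\<close>. This allows a matrix of any size to be replaced by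
  the infinite array that it truncates.\<close>

lemma givens_apply_cong:
  assumes "\<And>p. p < m \<Longrightarrow> f p = g p" "k < m" "p < m"
  shows "givens_apply c s k f p = givens_apply c s k g p"
  using assms(2,3) by (induction k arbitrary: p) (auto simp: assms(1))

text \<open>Linearity: rotating a matrix-vector product amounts to rotating the columns of the
  matrix.\<close>

lemma givens_apply_sum:
  "givens_apply c s k (\<lambda>p. \<Sum>q\<in>I. f q p * y q) p = (\<Sum>q\<in>I. givens_apply c s k (f q) p * y q)"
  by (induction k arbitrary: p)
    (auto simp: sum_distrib_left sum.distrib[symmetric] sum_subtractf[symmetric] algebra_simps)

lemma givens_apply_beyond: "k < p \<Longrightarrow> givens_apply c s k f p = f p"
  by (induction k) auto

text \<open>Each rotation preserves the sum of squares of the two entries it mixes, and both lie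
  below \<open>m\<close>.\<close>

lemma givens_apply_norm:
  assumes "\<And>l. l \<in> {1..k} \<Longrightarrow> (c l)\<^sup>2 + (s l)\<^sup>2 = 1" "k < m"
  shows "L2_set (givens_apply c s k f) {..<m} = L2_set f {..<m}"
  using assms
proof (induction k)
  case (Suc k)
  let ?g = "givens_apply c s k f" and ?h = "givens_apply c s (Suc k) f"
  have "(?h k)\<^sup>2 + (?h (Suc k))\<^sup>2 = ((c (Suc k))\<^sup>2 + (s (Suc k))\<^sup>2) * ((?g k)\<^sup>2 + (?g (Suc k))\<^sup>2)"
    by (simp add: power2_eq_square algebra_simps)
  then have two: "(?h k)\<^sup>2 + (?h (Suc k))\<^sup>2 = (?g k)\<^sup>2 + (?g (Suc k))\<^sup>2"
    using Suc.prems by simp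
  have split: "(\<Sum>p<m. F p) = F k + F (Suc k) + (\<Sum>p\<in>{..<m} - {k, Suc k}. F p)" for F :: "nat \<Rightarrow> real"
    using Suc.prems by (subst sum.subset_diff[of "{k, Suc k}"]) auto
  have "(\<Sum>p<m. (?h p)\<^sup>2) = (\<Sum>p<m. (?g p)\<^sup>2)"
    unfolding split two by (intro arg_cong2[where f = "(+)"] refl sum.cong) auto
  then have "L2_set ?h {..<m} = L2_set ?g {..<m}"
    by (simp only: L2_set_def)
  also have "\<dots> = L2_set f {..<m}"
    by (rule Suc.IH) (use Suc.prems in auto)
  finally show ?case .
qed simp

text \<open>Induction on the number of rotations. In the new column \<open>k\<close>, entry
  \<open>Suc k\<close> vanishes by \<open>elim\<close> and the later ones by the Hessenberg shape.
  Earlier columns are already zero in rows \<open>k\<close> and \<open>Suc k\<close>, so mixing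
  these rows keeps them zero.\<close>

lemma givens_apply_triangular:
  fixes t :: "nat \<Rightarrow> nat \<Rightarrow> real"
  assumes hess: "\<And>p q. p > Suc q \<Longrightarrow> t p q = 0"
    and elim: "\<And>l. l \<in> {1..k} \<Longrightarrow> givens_apply c s l (\<lambda>p. t p (l - 1)) l = 0"
    and "q < k" "q < p"
  shows "givens_apply c s k (\<lambda>p. t p q) p = 0"
  using assms(2-)
proof (induction k arbitrary: q p)
  case (Suc k)
  show ?case
  proof (cases "q = k")
    case True
    show ?thesis
    proof (cases "p = Suc k")
      case p: True
      show ?thesis using Suc.prems(1)[of "Suc k"] unfolding True p diff_Suc_1 by simp
    next
      case False
      then have "Suc k < p" using True Suc.prems(3) by simp
      then show ?thesis using hess True by (simp only: givens_apply_beyond)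
    qed
  next
    case False
    have "givens_apply c s k (\<lambda>p. t p q) p' = 0" if "q < p'" for p'
    proof (rule Suc.IH)
      show "givens_apply c s l (\<lambda>p. t p (l - 1)) l = 0" if "l \<in> {1..k}" for l
        using that by (intro Suc.prems(1)) simp
    qed (use False Suc.prems(2) that in auto)
    then show ?thesis using False Suc.prems(2,3) by simp
  qed
qed simp

section \<open>Bounding a single component of a solution\<close>

lemma square_system_solvable:
  fixes a :: "nat \<Rightarrow> nat \<Rightarrow> real"
  assumes "\<And>x. (\<And>p. p < n \<Longrightarrow> (\<Sum>q<n. a p q * x q) = 0) \<Longrightarrow> (\<And>q. q < n \<Longrightarrow> x q = 0)"
  obtains x where "\<And>p. p < n \<Longrightarrow> (\<Sum>q<n. a p q * x q) = f p"
proof -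
  let ?A = "mat n n (\<lambda>(p, q). a p q)"
  have A: "?A \<in> carrier_mat n n" by simp
  have idx: "(?A *\<^sub>v x) $ p = (\<Sum>q<n. a p q * x $ q)" if "x \<in> carrier_vec n" "p < n" for x p
    using that by (simp add: scalar_prod_def lessThan_atLeast0)
  have "det ?A \<noteq> 0"
  proof
    assume "det ?A = 0"
    then obtain x where x: "x \<in> carrier_vec n" "x \<noteq> 0\<^sub>v n" "?A *\<^sub>v x = 0\<^sub>v n"
      using det_0_iff_vec_prod_zero_field[OF A] by blast
    then have "\<And>p. p < n \<Longrightarrow> (\<Sum>q<n. a p q * x $ q) = 0"
      using idx by (metis index_zero_vec(1))
    then have "\<And>q. q < n \<Longrightarrow> x $ q = 0" by (rule assms)
    then show False using x by (auto simp: vec_eq_iff)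
  qed
  then obtain B where B: "B \<in> carrier_mat n n" "?A * B = 1\<^sub>m n"
    using det_non_zero_imp_unit[OF A] by (auto simp: Units_def ring_mat_def)
  let ?x = "B *\<^sub>v vec n f"
  have x: "?x \<in> carrier_vec n" using B by simp
  have "?A *\<^sub>v ?x = vec n f"
    using A B by (simp flip: assoc_mult_mat_vec[of _ n n _ n])
  then have "(\<Sum>q<n. a p q * ?x $ q) = f p" if "p < n" for p
    using idx[OF x that] that by simp
  then show ?thesis by (rule that)
qed

text \<open>The entries of \<open>y\<close> from \<open>n\<close> on are kept and the first \<open>n\<close> ones are changed, which turns
  the right-hand side into \<open>\<rho>\<close> times a unit vector.\<close>

lemma block_triangular_component_bound:
  fixes h :: "nat \<Rightarrow> nat \<Rightarrow> real"
  assumes n: "n < m"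
    and zero: "\<And>p q. q < n \<Longrightarrow> n \<le> p \<Longrightarrow> h p q = 0"
    and \<sigma>: "0 \<le> \<sigma>"
    and bound: "\<And>x. \<sigma> * L2_set x {..<m} \<le> L2_set (\<lambda>p. \<Sum>q<m. h p q * x q) {..<m}"
    and y: "\<And>p. n \<le> p \<Longrightarrow> p < m \<Longrightarrow> (\<Sum>q<m. h p q * y q) = (if p = n then \<rho> else 0)"
  shows "\<sigma> * \<bar>y n\<bar> \<le> \<bar>\<rho>\<bar>"
proof (cases "\<sigma> = 0")
  case False
  have split: "(\<Sum>q<m. F q) = (\<Sum>q<n. F q) + (\<Sum>q\<in>{n..<m}. F q)" for F :: "nat \<Rightarrow> real"
    using n by (simp add: lessThan_atLeast0 sum.atLeastLessThan_concat)
  \<comment> \<open>The leading block is injective: a kernel vector padded with zeros is annihilated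
    by all of \<open>h\<close>, and the lower bound with \<sigma> > 0 forces it to vanish.\<close>
  have inj: "x q = 0" if x: "\<And>p. p < n \<Longrightarrow> (\<Sum>q<n. h p q * x q) = 0" and q: "q < n" for x q
  proof -
    let ?x = "\<lambda>q. if q < n then x q else 0"
    have "(\<Sum>q<m. h p q * ?x q) = (\<Sum>q<n. h p q * x q)" for p
      unfolding split by simp
    moreover have "(\<Sum>q<n. h p q * x q) = 0" for p
      using x[of p] zero by (cases "p < n") auto
    ultimately have "\<sigma> * L2_set ?x {..<m} \<le> 0"
      using bound[of ?x] by (simp add: L2_set_def)
    then have "L2_set ?x {..<m} = 0"
      using \<sigma> False L2_set_nonneg[of ?x "{..<m}"] by (simp add: mult_le_0_iff)
    then have "\<forall>q\<in>{..<m}. ?x q = 0" by (simp only: L2_set_eq_0_iff finite_lessThan)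
    then have "?x q = 0" using q n by (intro bspec[of _ _ q]) auto
    then show ?thesis using q by simp
  qed
  \<comment> \<open>The new leading entries cancel the contribution of the kept ones in the first
    \<open>n\<close> rows. The other rows do not see this change, as \<open>h\<close> is zero there
    in the first \<open>n\<close> columns.\<close>
  obtain z where z: "\<And>p. p < n \<Longrightarrow> (\<Sum>q<n. h p q * z q) = - (\<Sum>q\<in>{n..<m}. h p q * y q)"
    by (rule square_system_solvable[where n = n and a = h and
          f = "\<lambda>p. - (\<Sum>q\<in>{n..<m}. h p q * y q)"]) (use inj in auto)
  let ?x = "\<lambda>q. if q < n then z q else y q"
  have Hx: "(\<Sum>q<m. h p q * ?x q) = (if p = n then \<rho> else 0)" if "p < m" for p
  proof (cases "p < n")
    case True
    then show ?thesis unfolding split using z by simp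
  next
    case False
    then have "(\<Sum>q<m. h p q * ?x q) = (\<Sum>q<m. h p q * y q)"
      using zero by (intro sum.cong) auto
    then show ?thesis using y False that by simp
  qed
  have "\<bar>y n\<bar> \<le> L2_set ?x {..<m}"
    using member_le_L2_set[of "{..<m}" n "\<lambda>q. \<bar>?x q\<bar>"] n by (simp add: L2_set_def)
  then have "\<sigma> * \<bar>y n\<bar> \<le> \<sigma> * L2_set ?x {..<m}" using \<sigma> by (rule mult_left_mono)
  also have "\<dots> \<le> L2_set (\<lambda>p. \<Sum>q<m. h p q * ?x q) {..<m}" by (rule bound)
  also have "\<dots> = L2_set (\<lambda>p. if p = n then \<rho> else 0) {..<m}"
    by (rule L2_set_cong) (use Hx in auto)
  also have "\<dots> = \<bar>\<rho>\<bar>"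
    using n by (simp add: L2_set_def if_distrib[of "\<lambda>x. x ^ 2"] cong: if_cong)
  finally show ?thesis .
qed simp

text \<open>Here \<open>y\<close> solves the system of size \<open>m\<close> and \<open>y'\<close>
  its leading subsystem of size \<open>n + 1\<close>. Both have the same right-hand side, and
  \<open>n\<close> rotations turn entry \<open>n\<close> of it into the same number
  \<open>?\<rho>\<close>. In the small system the last rotated row reads
  \<open>?\<rho> = ?h n n * y' n\<close>; in the large one the rotated matrix is block triangular
  and still obeys the lower bound, as rotations preserve norms.\<close>

lemma hessenberg_component_bound:
  fixes t :: "nat \<Rightarrow> nat \<Rightarrow> real"
  assumes hess: "\<And>p q. p > Suc q \<Longrightarrow> t p q = 0"
    and rot: "\<And>l. l \<in> {1..n} \<Longrightarrow> (c l)\<^sup>2 + (s l)\<^sup>2 = 1"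
    and elim: "\<And>l. l \<in> {1..n} \<Longrightarrow> givens_apply c s l (\<lambda>p. t p (l - 1)) l = 0"
    and n: "n < m"
    and \<sigma>: "0 \<le> \<sigma>"
    and bound: "\<And>x. \<sigma> * L2_set x {..<m} \<le> L2_set (\<lambda>p. \<Sum>q<m. t p q * x q) {..<m}"
    and y: "\<And>p. p < m \<Longrightarrow> (\<Sum>q<m. t p q * y q) = (if p = 0 then \<beta> else 0)"
    and y': "\<And>p. p \<le> n \<Longrightarrow> (\<Sum>q\<le>n. t p q * y' q) = (if p = 0 then \<beta> else 0)"
  shows "\<sigma> * \<bar>y n\<bar> \<le> \<bar>givens_apply c s n (\<lambda>p. t p n) n\<bar> * \<bar>y' n\<bar>"
proof -
  let ?h = "\<lambda>p q. givens_apply c s n (\<lambda>p. t p q) p"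
  let ?e = "\<lambda>p. if p = 0 then \<beta> else (0::real)"
  let ?\<rho> = "givens_apply c s n ?e n"
  have tri: "?h p q = 0" if "q < n" "n \<le> p" for p q
    using givens_apply_triangular[OF hess elim, of n q p] that by simp
  have "?\<rho> = givens_apply c s n (\<lambda>p. \<Sum>q\<le>n. t p q * y' q) n"
    by (rule givens_apply_cong[of "Suc n"]) (use y' in auto)
  also have "\<dots> = (\<Sum>q\<le>n. ?h n q * y' q)"
    by (rule givens_apply_sum)
  also have "\<dots> = (\<Sum>q\<le>n. if q = n then ?h n n * y' n else 0)"
    by (rule sum.cong) (use tri in auto)
  finally have \<rho>: "?\<rho> = ?h n n * y' n" by simp
  have "\<sigma> * \<bar>y n\<bar> \<le> \<bar>?\<rho>\<bar>"
  proof (rule block_triangular_component_bound[OF n tri \<sigma>])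
    fix x
    have "\<sigma> * L2_set x {..<m} \<le> L2_set (\<lambda>p. \<Sum>q<m. t p q * x q) {..<m}" by (rule bound)
    also have "\<dots> = L2_set (givens_apply c s n (\<lambda>p. \<Sum>q<m. t p q * x q)) {..<m}"
      by (rule givens_apply_norm[OF rot n, symmetric])
    also have "givens_apply c s n (\<lambda>p. \<Sum>q<m. t p q * x q) = (\<lambda>p. \<Sum>q<m. ?h p q * x q)"
      by (rule ext) (rule givens_apply_sum)
    finally show "\<sigma> * L2_set x {..<m} \<le> L2_set (\<lambda>p. \<Sum>q<m. ?h p q * x q) {..<m}" .
  next
    fix p assume p: "n \<le> p" "p < m"
    have "(\<Sum>q<m. ?h p q * y q) = givens_apply c s n (\<lambda>p. \<Sum>q<m. t p q * y q) p"
      by (simp add: givens_apply_sum)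
    also have "\<dots> = givens_apply c s n ?e p"
      by (rule givens_apply_cong[of m]) (use y p n in auto)
    finally show "(\<Sum>q<m. ?h p q * y q) = (if p = n then ?\<rho> else 0)"
      \<comment> \<open>Entries after \<open>n\<close> are not reached by the rotations, and there
        the right-hand side was zero from the start.\<close>
      using p by (auto simp: givens_apply_beyond)
  qed auto
  then show ?thesis by (simp add: \<rho> abs_mult)
qed

subsection \<open>The residual\<close>

lemma L2_set_sum_le: "L2_set (\<lambda>k. \<Sum>i\<in>I. f i k) A \<le> (\<Sum>i\<in>I. L2_set (f i) A)"
proof (induction I rule: infinite_finite_induct)
  case (insert i I)
  then show ?case
    using L2_set_triangle_ineq[of "f i" "\<lambda>k. \<Sum>i\<in>I. f i k" A] by simp
qed (auto simp: L2_set_def)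

lemma L2_set_scale: "L2_set (\<lambda>k. r * f k) A = \<bar>r\<bar> * L2_set f A"
  by (simp add: L2_set_def power_mult_distrib real_sqrt_mult flip: sum_distrib_left)

lemma vnorm_smult: "vnorm (r \<cdot>\<^sub>v x) = \<bar>r\<bar> * vnorm x"
  unfolding vnorm_def L2_set_scale[symmetric] by (intro L2_set_cong) auto

lemma mult_mat_vec_index:
  fixes B :: "real mat"
  assumes "B \<in> carrier_mat m n" "x \<in> carrier_vec n" "k < m"
  shows "(B *\<^sub>v x) $ k = (\<Sum>q<n. B $$ (k, q) * x $ q)"
  using assms by (simp add: scalar_prod_def lessThan_atLeast0)

section \<open>Dimensions and entries of the concrete matrices\<close>

lemma pencil_K_carrier [simp]: "pencil_K d n P \<in> carrier_mat (d * n) (d * n)"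
  by (simp add: pencil_K_def block_mat_def)

text \<open>There are \<open>1 + (d - 2) + 1\<close> diagonal blocks; with truncated subtraction
  this is \<open>d\<close> because \<open>2 \<le> d\<close>.\<close>

lemma pencil_M_carrier:
  assumes "2 \<le> d" "P d \<in> carrier_mat n n"
  shows "pencil_M a d n P \<in> carrier_mat (d * n) (d * n)"
proof -
  obtain d' where "d = Suc (Suc d')" using assms(1) by (auto simp: le_iff_add)
  then show ?thesis
    using carrier_matD[OF assms(2)]
    by (intro carrier_matI)
      (simp_all add: pencil_M_def dim_diag_block_mat sum_list_replicate algebra_simps)
qed

lemma pencil_rhs_carrier:
  assumes "1 \<le> d" "b \<in> carrier_vec n"
  shows "pencil_rhs d n b \<in> carrier_vec (d * n)"
proof -
  obtain d' where "d = Suc d'" using assms(1) by (cases d) auto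
  moreover have "0\<^sub>v (d' * n) @\<^sub>v b \<in> carrier_vec (d' * n + n)"
    using assms(2) by (intro append_carrier_vec) auto
  ultimately show ?thesis by (simp add: pencil_rhs_def add.commute)
qed

text \<open>One infinite array contains all the matrices \<open>T i\<close> and also the appended
  last rows of all \<open>Tu i\<close>. Writing it as a sum of three diagonals lets sums over it be
  split.\<close>

definition shifted_tridiag ::
  "real \<Rightarrow> (nat \<Rightarrow> real) \<Rightarrow> (nat \<Rightarrow> real) \<Rightarrow> (nat \<Rightarrow> real) \<Rightarrow> nat \<Rightarrow> nat \<Rightarrow> real" where
  "shifted_tridiag \<delta> \<alpha> \<beta> \<gamma> p q =
     (if p = q then 1 + \<delta> * \<alpha> (q + 1) else 0) + (if q = p + 1 then \<delta> * \<gamma> q else 0) +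
     (if p = q + 1 then \<delta> * \<beta> (q + 1) else 0)"

lemma shifted_tridiag_index:
  assumes "p < i" "q < i"
  shows "(1\<^sub>m i + \<delta> \<cdot>\<^sub>m tridiag \<alpha> \<beta> \<gamma> i) $$ (p, q) = shifted_tridiag \<delta> \<alpha> \<beta> \<gamma> p q"
  using assms by (auto simp: tridiag_def shifted_tridiag_def)

lemma append_last_entry_index:
  assumes "A \<in> carrier_mat i i" "0 < i" "p \<le> i" "q < i"
  shows "append_last_entry A e $$ (p, q) =
    (if p < i then A $$ (p, q) else if q = i - 1 then e else 0)"
  using carrier_matD[OF assms(1)] assms(2-)
  by (simp add: append_last_entry_def append_rows_def mat_of_row_def)

lemma append_last_entry_carrier:
  assumes "A \<in> carrier_mat i i"
  shows "append_last_entry A e \<in> carrier_mat (Suc i) i"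
  using carrier_matD[OF assms]
  by (intro carrier_matI) (simp_all add: append_last_entry_def append_rows_def mat_of_row_def)

section \<open>The Lanczos recurrence and the residual identity\<close>

lemma inexact_lanczos_carrier:
  assumes lan: "inexact_lanczos N M bt ct j z x v w r s \<alpha> \<beta> \<gamma>"
    and bt: "bt \<in> carrier_vec N" and "i \<le> j + 1"
  shows "v i \<in> carrier_vec N"
  using assms(3)
proof (induction i rule: less_induct)
  case (less i)
  show ?case
  proof (cases i)
    case 0
    then show ?thesis using lan by (simp add: inexact_lanczos_def)
  next
    case (Suc k)
    have "r k \<in> carrier_vec N"
    proof (cases "k = 0")
      case True
      then show ?thesis using lan bt by (simp add: inexact_lanczos_def)
    next
      case False
      then have rk: "r k = M *\<^sub>v z k - \<alpha> k \<cdot>\<^sub>v v k - \<gamma> (k-1) \<cdot>\<^sub>v v (k-1)"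
        using lan less.prems Suc by (auto simp: inexact_lanczos_def)
      \<comment> \<open>A difference of vectors takes the dimension of its subtrahend, so the
        dimension of \<open>r k\<close> is that of \<open>v (k-1)\<close>.\<close>
      have "v (k-1) \<in> carrier_vec N" using less.IH[of "k-1"] less.prems Suc by simp
      then show ?thesis unfolding rk by (intro carrier_vecI) simp
    qed
    moreover have "v i = (1 / \<beta> k) \<cdot>\<^sub>v r k"
      using lan less.prems Suc by (auto simp: inexact_lanczos_def)
    ultimately show ?thesis by simp
  qed
qed

text \<open>The definition of \<open>r i\<close> solved for the product with \<open>M\<close>; the
  nonzero \<open>\<beta> i\<close> undoes the normalization of \<open>v (i+1)\<close>.\<close>

lemma inexact_lanczos_recurrence:
  assumes lan: "inexact_lanczos N M bt ct j z x v w r s \<alpha> \<beta> \<gamma>"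
    and bt: "bt \<in> carrier_vec N" and M: "M \<in> carrier_mat N N"
    and i: "1 \<le> i" "i \<le> j" and \<beta>: "\<beta> i \<noteq> 0" and k: "k < N"
  shows "(M *\<^sub>v z i) $ k = \<beta> i * v (i+1) $ k + \<alpha> i * v i $ k + \<gamma> (i-1) * v (i-1) $ k"
proof -
  have v: "v i \<in> carrier_vec N" "v (i-1) \<in> carrier_vec N" "v (i+1) \<in> carrier_vec N"
    using inexact_lanczos_carrier[OF lan bt] i by auto
  have ri: "r i = M *\<^sub>v z i - \<alpha> i \<cdot>\<^sub>v v i - \<gamma> (i-1) \<cdot>\<^sub>v v (i-1)"
    and vi: "v (i+1) = (1 / \<beta> i) \<cdot>\<^sub>v r i"
    using lan i by (auto simp: inexact_lanczos_def)
  have "r i \<in> carrier_vec N" unfolding ri using v M by (intro carrier_vecI) simp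
  then have "\<beta> i * v (i+1) $ k = r i $ k" using vi \<beta> k by simp
  also have "\<dots> = (M *\<^sub>v z i) $ k - \<alpha> i * v i $ k - \<gamma> (i-1) * v (i-1) $ k"
    unfolding ri using v M k by (simp del: index_mult_mat_vec)
  finally show ?thesis by simp
qed

text \<open>Row \<open>p\<close> is paired with \<open>f (p + 1)\<close>, as Lanczos vectors are
  numbered from 1. Row \<open>j\<close> is included to cover the appended row, and
  \<open>f 0 = 0\<close>, which reflects \<open>v 0 = 0\<close>, accounts for the absent
  superdiagonal entry of column 0.\<close>

lemma shifted_tridiag_column_sum:
  fixes f :: "nat \<Rightarrow> real"
  assumes "q < j" "f 0 = 0"
  shows "(\<Sum>p\<le>j. shifted_tridiag \<delta> \<alpha> \<beta> \<gamma> p q * f (p + 1)) =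
    f (q + 1) + \<delta> * (\<beta> (q + 1) * f (q + 2) + \<alpha> (q + 1) * f (q + 1) + \<gamma> q * f q)"
proof -
  have "(\<Sum>p\<le>j. shifted_tridiag \<delta> \<alpha> \<beta> \<gamma> p q * f (p + 1)) =
      (\<Sum>p\<le>j. if p = q then (1 + \<delta> * \<alpha> (q + 1)) * f (q + 1) else 0) +
      (\<Sum>p\<le>j. if q = p + 1 then \<delta> * \<gamma> q * f q else 0) +
      (\<Sum>p\<le>j. if p = q + 1 then \<delta> * \<beta> (q + 1) * f (q + 2) else 0)"
    unfolding sum.distrib[symmetric] by (intro sum.cong) (auto simp: shifted_tridiag_def)
  also have "(\<Sum>p\<le>j. if q = p + 1 then \<delta> * \<gamma> q * f q else 0) = \<delta> * \<gamma> q * f q"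
    using assms by (cases q) auto
  finally show ?thesis using assms(1) by (simp add: algebra_simps)
qed

text \<open>Write \<open>K - \<mu> M\<close> as
  \<open>(K - \<sigma> M) + (\<sigma> - \<mu>) M\<close>. On \<open>z (q + 1)\<close> the first part
  gives the inner residual plus \<open>v (q + 1)\<close>, the second the Lanczos recurrence;
  together, the inner residual plus the Lanczos basis times a column of the extended matrix.
  Multiplication by \<open>y\<close> turns the first \<open>j\<close> rows into \<open>bt\<close>
  and row \<open>j\<close> into the approximate residual.\<close>

lemma shifted_residual:
  fixes \<mu> \<sigma> :: real
  assumes lan: "inexact_lanczos N M bt ct j z x v w r s \<alpha> \<beta> \<gamma>"
    and bt: "bt \<in> carrier_vec N" and M: "M \<in> carrier_mat N N" and K: "K \<in> carrier_mat N N"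
    and \<beta>: "\<And>i. i \<le> j \<Longrightarrow> \<beta> i \<noteq> 0" and j: "1 \<le> j" and y: "y \<in> carrier_vec j"
    and Ty: "\<And>p. p < j \<Longrightarrow>
      (\<Sum>q<j. shifted_tridiag (- \<mu> + \<sigma>) \<alpha> \<beta> \<gamma> p q * y $ q) = (if p = 0 then vnorm bt else 0)"
    and k: "k < N"
  shows "(bt - (K - \<mu> \<cdot>\<^sub>m M) *\<^sub>v (mat_of_cols N (map z [1..<j+1]) *\<^sub>v y)) $ k =
    ((\<mu> - \<sigma>) * \<beta> j * y $ (j - 1)) * v (j + 1) $ k +
    (\<Sum>i<j. - (y $ i) * ((K - \<sigma> \<cdot>\<^sub>m M) *\<^sub>v z (i + 1) - v (i + 1)) $ k)"
proof -
  let ?Z = "mat_of_cols N (map z [1..<j+1])" and ?A = "K - \<mu> \<cdot>\<^sub>m M"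
  let ?t = "shifted_tridiag (- \<mu> + \<sigma>) \<alpha> \<beta> \<gamma>"
  let ?p = "\<lambda>i. (K - \<sigma> \<cdot>\<^sub>m M) *\<^sub>v z (i + 1) - v (i + 1)"
  have z: "z (i + 1) \<in> carrier_vec N" if "i < j" for i
    using lan that by (auto simp: inexact_lanczos_def)
  have v: "v i \<in> carrier_vec N" if "i \<le> j + 1" for i
    using inexact_lanczos_carrier[OF lan bt that] .
  have v0: "v 0 $ k = 0" using lan k by (simp add: inexact_lanczos_def)
  have \<beta>0: "vnorm bt = \<beta> 0" and v1: "v 1 = (1 / \<beta> 0) \<cdot>\<^sub>v bt"
    using lan by (auto simp: inexact_lanczos_def)
  have Z: "?Z \<in> carrier_mat N j" 
    using mat_of_cols_carrier(1)[of N "map z [1..<j+1]"] by (simp del: upt_Suc)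
  have colZ: "col ?Z q = z (q + 1)" if "q < j" for q
    using that z[OF that] by (subst col_mat_of_cols) (auto simp del: upt_Suc)
  have A: "?A \<in> carrier_mat N N" using K M by (intro minus_carrier_mat) auto
  have zk: "(?A *\<^sub>v z (q + 1)) $ k = ?p q $ k + (\<Sum>p\<le>j. ?t p q * v (p + 1) $ k)" if q: "q < j" for q
  proof -
    have "(?A *\<^sub>v z (q + 1)) $ k =
        ((K - \<sigma> \<cdot>\<^sub>m M) *\<^sub>v z (q + 1)) $ k + (- \<mu> + \<sigma>) * (M *\<^sub>v z (q + 1)) $ k"
      using K M z[OF q] k
      by (simp add: scalar_prod_def algebra_simps sum_subtractf sum.distrib sum_distrib_left)
    also have "((K - \<sigma> \<cdot>\<^sub>m M) *\<^sub>v z (q + 1)) $ k = ?p q $ k + v (q + 1) $ k"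
      using K M v[of "q + 1"] q k by (simp del: index_mult_mat_vec)
    also have "(M *\<^sub>v z (q + 1)) $ k =
        \<beta> (q + 1) * v (q + 2) $ k + \<alpha> (q + 1) * v (q + 1) $ k + \<gamma> q * v q $ k"
      using inexact_lanczos_recurrence[OF lan bt M _ _ _ k, of "q + 1"] q \<beta> by simp
    also have "?p q $ k + v (q + 1) $ k + (- \<mu> + \<sigma>) * \<dots> =
        ?p q $ k + (\<Sum>p\<le>j. ?t p q * v (p + 1) $ k)"
      using shifted_tridiag_column_sum[OF q, of "\<lambda>i. v i $ k", OF v0] by simp
    finally show ?thesis .
  qed
  have "(?A *\<^sub>v (?Z *\<^sub>v y)) $ k = ((?A * ?Z) *\<^sub>v y) $ k"
    using A Z y by (simp only: assoc_mult_mat_vec)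
  also have "\<dots> = (\<Sum>q<j. (?A * ?Z) $$ (k, q) * y $ q)"
    by (rule mult_mat_vec_index[OF mult_carrier_mat[OF A Z] y k])
  also have "\<dots> = (\<Sum>q<j. (?A *\<^sub>v z (q + 1)) $ k * y $ q)"
  proof (rule sum.cong[OF refl])
    fix q assume "q \<in> {..<j}"
    then have q: "q < j" by simp
    have "(?A * ?Z) $$ (k, q) = row ?A k \<bullet> col ?Z q"
      using A Z k q by (intro index_mult_mat(1)) auto
    also have "\<dots> = (?A *\<^sub>v z (q + 1)) $ k"
      unfolding colZ[OF q] using A k by (intro index_mult_mat_vec[symmetric]) auto
    finally show "(?A * ?Z) $$ (k, q) * y $ q = (?A *\<^sub>v z (q + 1)) $ k * y $ q" by (rule arg_cong)
  qed
  also have "\<dots> = (\<Sum>q<j. ?p q $ k * y $ q + (\<Sum>p\<le>j. ?t p q * v (p + 1) $ k * y $ q))"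
    by (rule sum.cong) (simp_all only: zk lessThan_iff distrib_right sum_distrib_right)
  also have "\<dots> = (\<Sum>q<j. ?p q $ k * y $ q) + (\<Sum>q<j. \<Sum>p\<le>j. ?t p q * v (p + 1) $ k * y $ q)"
    by (rule sum.distrib)
  also have "(\<Sum>q<j. \<Sum>p\<le>j. ?t p q * v (p + 1) $ k * y $ q) =
      (\<Sum>p\<le>j. (\<Sum>q<j. ?t p q * y $ q) * v (p + 1) $ k)"
    unfolding sum_distrib_right by (subst sum.swap) (intro sum.cong refl, simp)
  also have "\<dots> = (\<Sum>p<j. (\<Sum>q<j. ?t p q * y $ q) * v (p + 1) $ k) +
      (\<Sum>q<j. ?t j q * y $ q) * v (j + 1) $ k"
    by (simp flip: lessThan_Suc_atMost)
  also have "(\<Sum>p<j. (\<Sum>q<j. ?t p q * y $ q) * v (p + 1) $ k) =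
      (\<Sum>p<j. if p = 0 then vnorm bt * v 1 $ k else 0)"
    by (rule sum.cong[OF refl], subst Ty) auto
  \<comment> \<open>The first Lanczos vector is the normalized \<open>bt\<close>, so the scaling by
    the norm cancels.\<close>
  also have "\<dots> = bt $ k"
    using j k bt \<beta>[of 0] by (simp add: v1[unfolded One_nat_def] \<beta>0)
  \<comment> \<open>Within the first \<open>j\<close> columns, row \<open>j\<close> has its
    subdiagonal entry only.\<close>
  also have "(\<Sum>q<j. ?t j q * y $ q) =
      (\<Sum>q<j. if q = j - 1 then (- \<mu> + \<sigma>) * \<beta> j * y $ (j - 1) else 0)"
    by (rule sum.cong) (auto simp: shifted_tridiag_def)
  also have "\<dots> = (- \<mu> + \<sigma>) * \<beta> j * y $ (j - 1)"
    using j by simp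
  finally have *: "(?A *\<^sub>v (?Z *\<^sub>v y)) $ k = (\<Sum>q<j. ?p q $ k * y $ q) +
      (bt $ k + (- \<mu> + \<sigma>) * \<beta> j * y $ (j - 1) * v (j + 1) $ k)" .
  have "(bt - ?A *\<^sub>v (?Z *\<^sub>v y)) $ k = bt $ k - (?A *\<^sub>v (?Z *\<^sub>v y)) $ k"
    using A k by (simp only: index_minus_vec dim_mult_mat_vec carrier_matD)
  then show ?thesis
    unfolding *
    by (simp add: sum_negf mult.commute[of "y $ _"] left_diff_distrib distrib_right
      del: index_minus_vec index_mult_mat_vec)
qed

text \<open>Invertibility excludes the result \<open>None\<close>, so \<open>the\<close> returns a
  genuine inverse.\<close>

lemma mat_inverse_solve:
  fixes A :: "real mat"
  assumes A: "A \<in> carrier_mat n n" and "invertible_mat A" and f: "f \<in> carrier_vec n"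
  shows "the (mat_inverse A) *\<^sub>v f \<in> carrier_vec n" "A *\<^sub>v (the (mat_inverse A) *\<^sub>v f) = f"
proof -
  obtain B where B: "A * B = 1\<^sub>m n" "B * A = 1\<^sub>m n" "B \<in> carrier_mat n n"
    using assms(2) A unfolding invertible_mat_def inverts_mat_def
    by (metis carrier_mat_triv carrier_matD index_mult_mat(2,3) index_one_mat(2,3))
  have "mat_inverse A \<noteq> None"
    using mat_inverse(1)[OF A, of undefined] B A by (auto simp: Units_def ring_mat_def)
  then obtain C where "mat_inverse A = Some C" by auto
  with mat_inverse(2)[OF A] have C: "mat_inverse A = Some C" "A * C = 1\<^sub>m n" "C \<in> carrier_mat n n"
    by auto
  show "the (mat_inverse A) *\<^sub>v f \<in> carrier_vec n" using C f by simp
  show "A *\<^sub>v (the (mat_inverse A) *\<^sub>v f) = f"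
    using C f A by (simp flip: assoc_mult_mat_vec[of _ n n _ n])
qed

section \<open>The bound on the true residual\<close>

theorem theorem8p4:
  fixes a \<mu> \<sigma> \<epsilon> :: real
    and d n j :: nat
    and P :: "nat \<Rightarrow> real mat"
    and b bt ct :: "real vec"
    and K M :: "real mat"
    and z x v w r s y u r_in r_app p :: "nat \<Rightarrow> real vec"
    and \<alpha> \<beta> \<gamma> cs sn \<Delta> :: "nat \<Rightarrow> real"
    and T Tu R :: "nat \<Rightarrow> real mat"
  assumes "0 < a" and "1 \<le> n" and "2 \<le> d"
    and "\<forall>l\<le>d. P l \<in> carrier_mat n n"
    and "b \<in> carrier_vec n" and "b \<noteq> 0\<^sub>v n"
    and "\<forall>t\<in>{-a..a}. invertible_mat (cheb_matrix a d n P t)"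
    and "\<mu> \<in> {-a..a}" and "\<sigma> \<in> {-a<..<a}" and "\<mu> \<noteq> \<sigma>" and "0 < \<epsilon>" and "1 \<le> j"
    and "K = pencil_K d n P" and "M = pencil_M a d n P" and "bt = pencil_rhs d n b"
    and "ct \<in> carrier_vec (d * n)" and "bt \<bullet> ct \<noteq> 0"
    and "inexact_lanczos (d * n) M bt ct j z x v w r s \<alpha> \<beta> \<gamma>"
    and "no_breakdown j r s"
    and "\<forall>i\<in>{1..j}. T i = 1\<^sub>m i + (- \<mu> + \<sigma>) \<cdot>\<^sub>m tridiag \<alpha> \<beta> \<gamma> i"
    and "\<forall>i\<in>{1..j}. invertible_mat (T i)"
    and "\<forall>i\<in>{1..j}. y i = the (mat_inverse (T i)) *\<^sub>v (vnorm bt \<cdot>\<^sub>v unit_vec i 0)"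
    and "\<forall>i\<in>{1..j}. u i = mat_of_cols (d * n) (map z [1..<i+1]) *\<^sub>v y i"
    and "\<forall>i\<in>{1..j}. r_in i = bt - (K - \<mu> \<cdot>\<^sub>m M) *\<^sub>v u i"
    and "\<forall>i\<in>{1..j}. r_app i = ((\<mu> - \<sigma>) * \<beta> i * (unit_vec i (i-1) \<bullet> y i)) \<cdot>\<^sub>v v (i+1)"
    and "\<forall>i\<in>{1..j}. Tu i = append_last_entry (T i) ((- \<mu> + \<sigma>) * \<beta> i)"
    and "givens_eliminates j Tu cs sn"
    and "\<forall>i\<in>{1..j}. R i = givens_product i cs sn (i-1) * T i"
    and "\<forall>i\<in>{1..j}. \<Delta> i = \<bar>R i $$ (i-1, i-1)\<bar> / \<bar>Tu i $$ (i, i-1)\<bar> * vnorm (r_app i)"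
    and "\<forall>i\<in>{1..j}. p i = (K - \<sigma> \<cdot>\<^sub>m M) *\<^sub>v z i - v i"
    and "\<forall>i\<in>{1..j}. vnorm (p i) \<le> 1 / real j * (smallest_singular_value (T j) / \<Delta> i) * \<epsilon>"
  shows "vnorm (r_in j) \<le> vnorm (r_app j) + \<epsilon>"
proof -
  define t where "t = shifted_tridiag (- \<mu> + \<sigma>) \<alpha> \<beta> \<gamma>"
  define S where "S = smallest_singular_value (T j)"
  have j: "1 \<le> j" by fact
  have K: "K \<in> carrier_mat (d * n) (d * n)"
    unfolding \<open>K = _\<close> by (rule pencil_K_carrier)
  have M: "M \<in> carrier_mat (d * n) (d * n)"
    unfolding \<open>M = _\<close> using assms(3,4) by (intro pencil_M_carrier) auto
  have bt: "bt \<in> carrier_vec (d * n)"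
    unfolding \<open>bt = _\<close> using assms(3,5) by (intro pencil_rhs_carrier) auto
  have lan: "inexact_lanczos (d * n) M bt ct j z x v w r s \<alpha> \<beta> \<gamma>" by fact
  have \<beta>r: "\<beta> i = vnorm (r i)" if "i \<le> j" for i
    using lan that by (simp add: inexact_lanczos_def)
  \<comment> \<open>A zero norm would make \<open>r i\<close> the zero vector, hence
    \<open>s i \<bullet> r i = 0\<close>, which is a breakdown.\<close>
  have \<beta>: "\<beta> i \<noteq> 0" if i: "i \<le> j" for i
  proof
    assume "\<beta> i = 0"
    then have "\<forall>k\<in>{..<dim_vec (r i)}. r i $ k = 0"
      unfolding \<beta>r[OF i] vnorm_def by (simp only: L2_set_eq_0_iff finite_lessThan)
    then have "s i \<bullet> r i = 0" by (simp add: scalar_prod_def)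
    then show False using \<open>no_breakdown j r s\<close> i by (simp add: no_breakdown_def)
  qed
  have T_def: "T i = 1\<^sub>m i + (- \<mu> + \<sigma>) \<cdot>\<^sub>m tridiag \<alpha> \<beta> \<gamma> i" if "i \<in> {1..j}" for i
    using assms(20) that by blast
  have T: "T i \<in> carrier_mat i i" if "i \<in> {1..j}" for i
    unfolding T_def[OF that] by (simp add: tridiag_def)
  have Tt: "T i $$ (p, q) = t p q" if "i \<in> {1..j}" "p < i" "q < i" for i p q
    unfolding T_def[OF that(1)] t_def by (rule shifted_tridiag_index) fact+
  have rhs: "vnorm bt \<cdot>\<^sub>v unit_vec i 0 \<in> carrier_vec i" for i by simp
  have yi: "y i = the (mat_inverse (T i)) *\<^sub>v (vnorm bt \<cdot>\<^sub>v unit_vec i 0)"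
    "invertible_mat (T i)" if "i \<in> {1..j}" for i
    using assms(21,22) that by blast+
  have y: "y i \<in> carrier_vec i" and Ty: "T i *\<^sub>v y i = vnorm bt \<cdot>\<^sub>v unit_vec i 0"
    if i: "i \<in> {1..j}" for i
    using mat_inverse_solve[OF T[OF i] yi(2)[OF i] rhs] yi(1)[OF i] by simp_all
  have ty: "(\<Sum>q<i. t p q * y i $ q) = (if p = 0 then vnorm bt else 0)"
    if i: "i \<in> {1..j}" and p: "p < i" for i p
  proof -
    have "(\<Sum>q<i. t p q * y i $ q) = (T i *\<^sub>v y i) $ p"
      unfolding mult_mat_vec_index[OF T[OF i] y[OF i] p] using Tt[OF i p] by (intro sum.cong) auto
    then show ?thesis unfolding Ty[OF i] using p by simp
  qed
  have Tu_def: "Tu i = append_last_entry (T i) ((- \<mu> + \<sigma>) * \<beta> i)" if "i \<in> {1..j}" for i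
    using assms(26) that by blast
  have Tut: "Tu i $$ (p, q) = t p q" if i: "i \<in> {1..j}" and pq: "p \<le> i" "q < i" for i p q
  proof (cases "p < i")
    case True
    then show ?thesis
      unfolding Tu_def[OF i] using i pq Tt[OF i]
      by (subst append_last_entry_index[OF T[OF i]]) auto
  next
    case False
    then show ?thesis
      unfolding Tu_def[OF i] using i pq
      by (subst append_last_entry_index[OF T[OF i]]) (auto simp: t_def shifted_tridiag_def)
  qed
  \<comment> \<open>Rotation \<open>l\<close> is read off from the elimination of size
    \<open>Suc l\<close>, which acts on \<open>Tu l\<close>; hence the restriction
    \<open>l < j\<close>.\<close>
  have rot: "(cs l)\<^sup>2 + (sn l)\<^sup>2 = 1"
    and elim: "givens_apply cs sn l (\<lambda>p. t p (l - 1)) l = 0" if l: "1 \<le> l" "l < j" for l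
  proof -
    have "Suc l \<in> {1..j}" "l \<in> {1..Suc l - 1}" using l by auto
    then have "(cs l)\<^sup>2 + (sn l)\<^sup>2 = 1 \<and>
        (givens_product (Suc l) cs sn l * Tu (Suc l - 1)) $$ (l, l-1) = 0"
      using \<open>givens_eliminates j Tu cs sn\<close> unfolding givens_eliminates_def by blast
    then have *: "(cs l)\<^sup>2 + (sn l)\<^sup>2 = 1"
        "(givens_product (Suc l) cs sn l * Tu l) $$ (l, l-1) = 0"
      by (simp_all only: diff_Suc_1)
    then show "(cs l)\<^sup>2 + (sn l)\<^sup>2 = 1" by simp
    have lj: "l \<in> {1..j}" using l by simp
    have "Tu l \<in> carrier_mat (Suc l) l"
      unfolding Tu_def[OF lj] using T[OF lj] by (rule append_last_entry_carrier)
    then have "givens_apply cs sn l (\<lambda>p. Tu l $$ (p, l - 1)) l = 0"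
      using *(2) l by (subst givens_product_mult_index[symmetric]) auto
    moreover have "givens_apply cs sn l (\<lambda>p. Tu l $$ (p, l - 1)) l =
        givens_apply cs sn l (\<lambda>p. t p (l - 1)) l"
      by (rule givens_apply_cong[of "Suc l"]) (use Tut[OF lj] l in auto)
    ultimately show "givens_apply cs sn l (\<lambda>p. t p (l - 1)) l = 0" by simp
  qed
  have app: "r_app i = ((\<mu> - \<sigma>) * \<beta> i * y i $ (i - 1)) \<cdot>\<^sub>v v (i+1)" if i: "i \<in> {1..j}" for i
  proof -
    have "unit_vec i (i-1) \<bullet> y i = y i $ (i - 1)"
      using i by (intro scalar_prod_left_unit[OF y[OF i]]) auto
    then show ?thesis using assms(25) i by simp
  qed
  \<comment> \<open>\<open>v (i+1)\<close> has norm 1, so the norm of \<open>r_app i\<close>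
    contains the absolute value of the subdiagonal entry as a factor, which cancels the denominator.
    Hypotheses \<mu> \<noteq> \<sigma> and \<open>\<beta> i \<noteq> 0\<close> make it
    nonzero.\<close>
  have \<Delta>: "\<Delta> i = \<bar>givens_apply cs sn (i - 1) (\<lambda>p. t p (i - 1)) (i - 1)\<bar> * \<bar>y i $ (i - 1)\<bar>"
    if i: "i \<in> {1..j}" for i
  proof -
    have i1: "i - 1 < i" using i by auto
    have "R i $$ (i-1, i-1) = (givens_product i cs sn (i-1) * T i) $$ (i-1, i-1)"
      using assms(28) i by simp
    also have "\<dots> = givens_apply cs sn (i-1) (\<lambda>p. T i $$ (p, i-1)) (i-1)"
      by (rule givens_product_mult_index[OF T[OF i] i1 i1 i1])
    also have "\<dots> = givens_apply cs sn (i-1) (\<lambda>p. t p (i-1)) (i-1)"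
      by (rule givens_apply_cong[of i]) (use Tt[OF i] i1 in auto)
    finally have Rt: "R i $$ (i-1, i-1) = givens_apply cs sn (i-1) (\<lambda>p. t p (i-1)) (i-1)" .
    have "v (i+1) = (1 / \<beta> i) \<cdot>\<^sub>v r i"
      using lan i by (auto simp: inexact_lanczos_def)
    then have "vnorm (v (i+1)) = \<bar>1 / \<beta> i\<bar> * vnorm (r i)" by (simp only: vnorm_smult)
    also have "\<dots> = 1"
      using \<beta>r[of i] \<beta>[of i] i vnorm_nonneg[of "r i"] by simp
    finally have "vnorm (r_app i) = \<bar>(\<mu> - \<sigma>) * \<beta> i\<bar> * \<bar>y i $ (i - 1)\<bar>"
      unfolding app[OF i] vnorm_smult by (simp add: abs_mult)
    moreover have "Tu i $$ (i, i - 1) = - ((\<mu> - \<sigma>) * \<beta> i)"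
      using Tut[OF i, of i "i - 1"] i by (auto simp: t_def shifted_tridiag_def algebra_simps)
    moreover have "\<bar>(\<mu> - \<sigma>) * \<beta> i\<bar> \<noteq> 0"
      using \<open>\<mu> \<noteq> \<sigma>\<close> \<beta>[of i] i by simp
    moreover have "\<Delta> i = \<bar>R i $$ (i-1, i-1)\<bar> / \<bar>Tu i $$ (i, i-1)\<bar> * vnorm (r_app i)"
      using assms(29) i by blast
    ultimately show ?thesis unfolding Rt[symmetric] by simp
  qed
  have jj: "j \<in> {1..j}" using j by simp
  have S0: "0 \<le> S"
    unfolding S_def using smallest_singular_value_nonneg[OF T[OF jj]] j by simp
  have Sbound: "S * L2_set f {..<j} \<le> L2_set (\<lambda>p. \<Sum>q<j. t p q * f q) {..<j}" for f
  proof -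
    have f: "vec j f \<in> carrier_vec j" by simp
    have "S * vnorm (vec j f) \<le> vnorm (T j *\<^sub>v vec j f)"
      unfolding S_def using j by (intro smallest_singular_value_le[OF T[OF jj] _ f]) simp
    also have "vnorm (vec j f) = L2_set f {..<j}"
      unfolding vnorm_def by (intro L2_set_cong) auto
    also have "vnorm (T j *\<^sub>v vec j f) = L2_set (\<lambda>p. (T j *\<^sub>v vec j f) $ p) {..<j}"
      using T[OF jj] by (simp only: vnorm_def dim_mult_mat_vec carrier_matD)
    also have "\<dots> = L2_set (\<lambda>p. \<Sum>q<j. t p q * f q) {..<j}"
    proof (rule L2_set_cong[OF refl])
      fix p assume "p \<in> {..<j}"
      then have p: "p < j" by simp
      show "(T j *\<^sub>v vec j f) $ p = (\<Sum>q<j. t p q * f q)"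
        unfolding mult_mat_vec_index[OF T[OF jj] f p] using Tt[OF jj p] by (intro sum.cong) auto
    qed
    finally show ?thesis .
  qed
  \<comment> \<open>Component \<open>i\<close>, counted from 0, belongs to step
    \<open>i + 1\<close>: the subsystem is that of \<open>y (i + 1)\<close>, reduced by
    \<open>i\<close> rotations.\<close>
  have y\<Delta>: "S * \<bar>y j $ i\<bar> \<le> \<Delta> (i + 1)" if i: "i < j" for i
  proof -
    have ij: "i + 1 \<in> {1..j}" using i by simp
    have "S * \<bar>y j $ i\<bar> \<le> \<bar>givens_apply cs sn i (\<lambda>p. t p i) i\<bar> * \<bar>y (i + 1) $ i\<bar>"
    proof (rule hessenberg_component_bound[where t = t and y = "($) (y j)" and
          y' = "($) (y (i + 1))" and \<beta> = "vnorm bt", OF _ _ _ i S0 Sbound])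
      fix p assume "p \<le> i"
      then show "(\<Sum>q\<le>i. t p q * y (i + 1) $ q) = (if p = 0 then vnorm bt else 0)"
        using ty[OF ij, of p] by (simp add: lessThan_Suc_atMost)
    qed (use rot elim ty[OF jj] i in \<open>auto simp: t_def shifted_tridiag_def\<close>)
    then show ?thesis using \<Delta>[OF ij] by simp
  qed
  \<comment> \<open>The factor \<open>S / \<Delta> (i + 1)\<close> in the tolerance offsets the size
    of component \<open>i\<close> of \<open>y j\<close>, so each of the \<open>j\<close> inner
    residuals costs at most one \<open>j\<close>th of \<epsilon>.\<close>
  have summand: "\<bar>- (y j $ i)\<bar> * vnorm (p (i + 1)) \<le> \<epsilon> / real j" if i: "i < j" for i
  proof -
    have le: "vnorm (p (i + 1)) \<le> 1 / real j * (S / \<Delta> (i + 1)) * \<epsilon>"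
      unfolding S_def using assms(31) i by simp
    have \<Delta>0: "0 \<le> \<Delta> (i + 1)" using \<Delta>[of "i + 1"] i by simp
    have "\<bar>y j $ i\<bar> * vnorm (p (i + 1)) \<le> \<bar>y j $ i\<bar> * (1 / real j * (S / \<Delta> (i + 1)) * \<epsilon>)"
      using le by (rule mult_left_mono) simp
    also have "\<dots> = (S * \<bar>y j $ i\<bar> / \<Delta> (i + 1)) * (\<epsilon> / real j)" by (simp add: mult_ac)
    also have "\<dots> \<le> 1 * (\<epsilon> / real j)"
    proof (rule mult_right_mono)
      show "S * \<bar>y j $ i\<bar> / \<Delta> (i + 1) \<le> 1"
        \<comment> \<open>if \<open>\<Delta> (i + 1) = 0\<close>, the left-hand side is the junk value 0\<close>
        using y\<Delta>[OF i] \<Delta>0 by (cases "\<Delta> (i + 1) = 0") (simp_all add: divide_le_eq_1)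
    qed (use \<open>0 < \<epsilon>\<close> in simp)
    finally show ?thesis by simp
  qed
  let ?a = "(\<mu> - \<sigma>) * \<beta> j * y j $ (j - 1)"
  have u: "u j = mat_of_cols (d * n) (map z [1..<j+1]) *\<^sub>v y j"
    using assms(23) jj by blast
  have r_in: "r_in j = bt - (K - \<mu> \<cdot>\<^sub>m M) *\<^sub>v (mat_of_cols (d * n) (map z [1..<j+1]) *\<^sub>v y j)"
    using assms(24) jj unfolding u[symmetric] by blast
  have p: "p i = (K - \<sigma> \<cdot>\<^sub>m M) *\<^sub>v z i - v i" if "i \<in> {1..j}" for i
    using assms(30) that by blast
  have vc: "v i \<in> carrier_vec (d * n)" if "i \<le> j + 1" for i
    using inexact_lanczos_carrier[OF lan bt that] .
  have dim_in: "dim_vec (r_in j) = d * n"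
    unfolding r_in using K M by (simp only: index_minus_vec dim_mult_mat_vec index_minus_mat
        index_smult_mat carrier_matD)
  have dim_app: "dim_vec (r_app j) = d * n"
    unfolding app[OF jj] using vc[of "j + 1"] by simp
  have dim_p: "dim_vec (p (i + 1)) = d * n" if "i < j" for i
    using p[of "i + 1"] vc[of "i + 1"] that by simp
  have "vnorm (r_in j) = L2_set (\<lambda>k. r_app j $ k + (\<Sum>i<j. - (y j $ i) * p (i + 1) $ k)) {..<d * n}"
    unfolding vnorm_def dim_in
  proof (rule L2_set_cong[OF refl])
    fix k assume "k \<in> {..<d * n}"
    then have k: "k < d * n" by simp
    have "r_in j $ k = ?a * v (j + 1) $ k +
        (\<Sum>i<j. - (y j $ i) * ((K - \<sigma> \<cdot>\<^sub>m M) *\<^sub>v z (i + 1) - v (i + 1)) $ k)"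
      unfolding r_in
      by (rule shifted_residual[OF lan bt M K \<beta> j y[OF jj] ty[OF jj, unfolded t_def] k])
    also have "?a * v (j + 1) $ k = r_app j $ k"
      unfolding app[OF jj] using vc[of "j + 1"] k by simp
    also have "(\<Sum>i<j. - (y j $ i) * ((K - \<sigma> \<cdot>\<^sub>m M) *\<^sub>v z (i + 1) - v (i + 1)) $ k) =
        (\<Sum>i<j. - (y j $ i) * p (i + 1) $ k)"
      by (rule sum.cong) (simp_all add: p del: index_minus_vec)
    finally show "r_in j $ k = r_app j $ k + (\<Sum>i<j. - (y j $ i) * p (i + 1) $ k)" .
  qed
  also have "\<dots> \<le> L2_set (\<lambda>k. r_app j $ k) {..<d * n} +
      L2_set (\<lambda>k. \<Sum>i<j. - (y j $ i) * p (i + 1) $ k) {..<d * n}"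
    by (rule L2_set_triangle_ineq)
  also have "\<dots> \<le> vnorm (r_app j) + (\<Sum>i<j. L2_set (\<lambda>k. - (y j $ i) * p (i + 1) $ k) {..<d * n})"
    unfolding vnorm_def dim_app by (intro add_left_mono L2_set_sum_le)
  also have "(\<Sum>i<j. L2_set (\<lambda>k. - (y j $ i) * p (i + 1) $ k) {..<d * n}) =
      (\<Sum>i<j. \<bar>- (y j $ i)\<bar> * vnorm (p (i + 1)))"
    unfolding L2_set_scale by (rule sum.cong) (simp_all only: vnorm_def dim_p lessThan_iff)
  also have "\<dots> \<le> (\<Sum>i<j. \<epsilon> / real j)"
    by (rule sum_mono) (use summand in auto)
  also have "\<dots> = \<epsilon>" using j by simp
  finally show ?thesis by simp
qed

end
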